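(* Let $V:S^{m-1}\to S^{m-1}$, $(Vx)_k=\sum_{i,j=1}^m p_{ij,k}x_ix_j$, be a dissipative quadratic stochastic operator, and put $a_{ij}=(p_{ij,1},p_{ij,2},\dots,p_{ij,m})\in S^{m-1}$ for $i,j=1,\dots,m$. Then $(a_{ii})_{\downarrow}=e_1=(1,0,\dots,0)$ for all $i=1,\dots,m$.
   Context: $S^{m-1}=\{x\in\mathbb{R}^m: x_i\ge 0,\ \sum_{i=1}^m x_i=1\}$. A quadratic stochastic operator (q.s.o.) is a map $V:S^{m-1}\to S^{m-1}$ of the form $(Vx)_k=\sum_{i,j=1}^m p_{ij,k}x_ix_j$, $k=1,\dots,m$, where $p_{ij,k}=p_{ji,k}\ge 0$ and $\sum_{k=1}^m p_{ij,k}=1$ for all $i,j$. For $x\in\mathbb{R}^m$, let $x_{\downarrow}=(x_{[1]},\dots,x_{[m]})$ denote the decreasing rearrangement of $x$ ($x_{[1]}\ge\cdots\ge x_{[m]}$). For $x,y\in\mathbb{R}^m$, write $x\prec y$ (equivalently $y\succ x$) if $\sum_{i=1}^k x_{[i]}\le\sum_{i=1}^k y_{[i]}$ for $k=1,\dots,m-1$ and $\sum_{i=1}^m x_{[i]}=\sum_{i=1}^m y_{[i]}$. $V$ is dissipative if $Vx\succ x$ for all $x\in S^{m-1}$. *)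

theory Defs
  imports "HOL-Analysis.Analysis" "HOL-Library.Multiset"
begin

text \<open>
  Vectors of \<open>\<real>\<^sup>m\<close> have type \<^typ>\<open>real ^ 'm\<close> with \<open>m = CARD('m)\<close>.
\<close>

definition prob_simplex :: "(real ^ 'm) set" where
  "prob_simplex = {x. (\<forall>i. 0 \<le> x $ i) \<and> (\<Sum>i\<in>UNIV. x $ i) = 1}"

definition stochastic_coeffs :: "('m::finite \<Rightarrow> 'm \<Rightarrow> 'm \<Rightarrow> real) \<Rightarrow> bool" where
  "stochastic_coeffs p \<longleftrightarrow>
     (\<forall>i j k. p i j k = p j i k \<and> 0 \<le> p i j k) \<and> (\<forall>i j. (\<Sum>k\<in>UNIV. p i j k) = 1)"

text \<open>
  The operator acts on the simplex only, so the values of \<open>V\<close> elsewhere are left unconstrained.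
\<close>

definition qso_with_coeffs ::
    "('m::finite \<Rightarrow> 'm \<Rightarrow> 'm \<Rightarrow> real) \<Rightarrow> (real ^ 'm \<Rightarrow> real ^ 'm) \<Rightarrow> bool" where
  "qso_with_coeffs p V \<longleftrightarrow> stochastic_coeffs p \<and>
     (\<forall>x\<in>prob_simplex. \<forall>k. V x $ k = (\<Sum>i\<in>UNIV. \<Sum>j\<in>UNIV. p i j k * x $ i * x $ j))"

text \<open>
  The index type carries no order, so the decreasing rearrangement \<open>(x\<^sub>[\<^sub>1\<^sub>], \<dots>, x\<^sub>[\<^sub>m\<^sub>])\<close>
  is the list of all coordinates (with multiplicity) in decreasing order. Lists are
  indexed from \<open>0\<close>: \<open>x\<^sub>[\<^sub>i\<^sub>]\<close> is \<open>decreasing_rearrangement x ! (i - 1)\<close>.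
\<close>

definition decreasing_rearrangement :: "real ^ 'm \<Rightarrow> real list" where
  "decreasing_rearrangement x = rev (sorted_list_of_multiset {# x $ i. i \<in># mset_set UNIV #})"

definition majorized :: "real ^ 'm \<Rightarrow> real ^ 'm \<Rightarrow> bool" (infix "\<prec>\<^sub>m" 50) where
  "x \<prec>\<^sub>m y \<longleftrightarrow>
     (\<forall>k\<in>{1..CARD('m) - 1}.
        (\<Sum>i<k. decreasing_rearrangement x ! i) \<le> (\<Sum>i<k. decreasing_rearrangement y ! i)) \<and>
     (\<Sum>i<CARD('m). decreasing_rearrangement x ! i) =
       (\<Sum>i<CARD('m). decreasing_rearrangement y ! i)"

definition dissipative :: "(real ^ 'm \<Rightarrow> real ^ 'm) \<Rightarrow> bool" where
  "dissipative V \<longleftrightarrow> (\<forall>x\<in>prob_simplex. x \<prec>\<^sub>m V x)"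

definition coeff_vector :: "('m::finite \<Rightarrow> 'm \<Rightarrow> 'm \<Rightarrow> real) \<Rightarrow> 'm \<Rightarrow> 'm \<Rightarrow> real ^ 'm" where
  "coeff_vector p i j = (\<chi> k. p i j k)"

lemma mset_decreasing_rearrangement:
  "mset (decreasing_rearrangement x) = {# x $ i. i \<in># mset_set UNIV #}"
  by (simp add: decreasing_rearrangement_def)

lemma sorted_decreasing_rearrangement: "sorted_wrt (\<ge>) (decreasing_rearrangement x)"
  by (simp add: decreasing_rearrangement_def sorted_wrt_rev)

lemma length_decreasing_rearrangement:
  fixes x :: "real ^ 'm"
  shows "length (decreasing_rearrangement x) = CARD('m)"
  by (metis mset_decreasing_rearrangement size_image_mset size_mset size_mset_set)

lemma coeff_vector_in_prob_simplex:
  "stochastic_coeffs p \<Longrightarrow> coeff_vector p i j \<in> prob_simplex"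
  by (simp add: stochastic_coeffs_def coeff_vector_def prob_simplex_def)

lemma qso_maps_prob_simplex:
  assumes "qso_with_coeffs p V" "x \<in> prob_simplex"
  shows "V x \<in> prob_simplex"
proof -
  have p: "stochastic_coeffs p"
    and V: "\<And>k. V x $ k = (\<Sum>i\<in>UNIV. \<Sum>j\<in>UNIV. p i j k * x $ i * x $ j)"
    using assms by (auto simp: qso_with_coeffs_def)
  have x: "\<And>i. 0 \<le> x $ i" "(\<Sum>i\<in>UNIV. x $ i) = 1"
    using assms(2) by (auto simp: prob_simplex_def)
  have "(\<Sum>k\<in>UNIV. V x $ k) = (\<Sum>i\<in>UNIV. \<Sum>k\<in>UNIV. \<Sum>j\<in>UNIV. p i j k * x $ i * x $ j)"
    unfolding V by (rule sum.swap)
  also have "\<dots> = (\<Sum>i\<in>UNIV. \<Sum>j\<in>UNIV. \<Sum>k\<in>UNIV. p i j k * x $ i * x $ j)"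
    by (intro sum.cong refl sum.swap)
  also have "\<dots> = (\<Sum>i\<in>UNIV. \<Sum>j\<in>UNIV. x $ i * x $ j)"
    using p by (simp add: stochastic_coeffs_def flip: sum_distrib_right)
  also have "\<dots> = 1"
    using x(2) by (simp flip: sum_distrib_left)
  finally show ?thesis
    using p x(1) by (auto simp: prob_simplex_def V stochastic_coeffs_def intro!: sum_nonneg)
qed

end

theory Submission
  imports Defs
begin

text \<open>
  A vertex \<open>e\<^sub>i\<close> of the simplex is mapped to \<open>a\<^sub>i\<^sub>i\<close>, so dissipativity gives \<open>e\<^sub>i \<prec> a\<^sub>i\<^sub>i\<close>. Hence the
  largest coordinate of \<open>a\<^sub>i\<^sub>i\<close> is at least \<open>1\<close>, and the nonnegative remaining coordinates vanish.
\<close>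

lemma axis_in_prob_simplex: "axis i 1 \<in> prob_simplex"
  by (simp add: prob_simplex_def axis_def)

lemma qso_axis:
  assumes "qso_with_coeffs p V"
  shows "V (axis i 1) = coeff_vector p i i"
proof (rule vec_eq_iff[THEN iffD2], rule allI)
  fix k
  have "V (axis i 1) $ k = (\<Sum>a\<in>UNIV. \<Sum>b\<in>UNIV. p a b k * axis i 1 $ a * axis i 1 $ b)"
    using assms axis_in_prob_simplex by (auto simp: qso_with_coeffs_def)
  also have "\<dots> = (\<Sum>a\<in>UNIV. if a = i then p a i k else 0)"
    \<comment> \<open>The factor \<open>axis i 1 $ b\<close> keeps only \<open>b = i\<close> in the
      inner sum, and \<open>axis i 1 $ a\<close> then keeps only \<open>a = i\<close>.\<close>
    by (intro sum.cong) (auto simp: axis_def if_distrib cong: if_cong)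
  also have "\<dots> = coeff_vector p i i $ k"
    by (simp add: coeff_vector_def)
  finally show "V (axis i 1) $ k = coeff_vector p i i $ k" .
qed

lemma set_decreasing_rearrangement:
  "set (decreasing_rearrangement x) = range (\<lambda>i. x $ i)"
proof -
  have "set (decreasing_rearrangement x) = set_mset (mset (decreasing_rearrangement x))"
    by simp
  then show ?thesis
    unfolding mset_decreasing_rearrangement by simp
qed

text \<open>A sum does not depend on order, so it can be read off the multiset of entries, where the
  sorting disappears.\<close>

lemma sum_list_decreasing_rearrangement:
  "sum_list (decreasing_rearrangement x) = (\<Sum>i\<in>UNIV. x $ i)"
proof -
  have "sum_list (decreasing_rearrangement x) = sum_mset (mset (decreasing_rearrangement x))"
    by (simp add: sum_mset_sum_list)
  then show ?thesis
    unfolding mset_decreasing_rearrangement by (simp add: sum_unfold_sum_mset)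
qed

text \<open>Every coordinate occurs in the list, and the head of a decreasing list bounds all its
  entries.\<close>

lemma component_le_decreasing_rearrangement_0:
  "x $ i \<le> decreasing_rearrangement x ! 0"
proof -
  have "x $ i \<in> set (decreasing_rearrangement x)"
    by (simp add: set_decreasing_rearrangement)
  then show ?thesis
    using sorted_decreasing_rearrangement[of x]
    by (cases "decreasing_rearrangement x") auto
qed

lemma majorized_decreasing_rearrangement_0:
  fixes x y :: "real ^ 'm"
  assumes "x \<prec>\<^sub>m y"
  shows "decreasing_rearrangement x ! 0 \<le> decreasing_rearrangement y ! 0"
proof (cases "CARD('m) = 1")
  \<comment> \<open>In dimension 1 no partial sum is compared, since
    \<open>{1..CARD('m) - 1}\<close> is empty. The equality of the total sums, each with a single
    term, takes over.\<close>
  case True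
  then show ?thesis
    using assms by (simp add: majorized_def)
next
  case False
  \<comment> \<open>\<open>CARD('m)\<close> is positive and not 1, hence at least 2, so
    \<open>k = 1\<close> is among the compared partial sums.\<close>
  then have "1 \<in> {1..CARD('m) - 1}"
    using zero_less_card_finite[where 'a = 'm] by (simp del: zero_less_card_finite)
  then have "(\<Sum>j<1. decreasing_rearrangement x ! j) \<le> (\<Sum>j<1. decreasing_rearrangement y ! j)"
    using assms unfolding majorized_def by blast
  then show ?thesis
    by simp
qed

lemma decreasing_rearrangement_vertex:
  fixes y :: "real ^ 'm"
  assumes y: "y \<in> prob_simplex" and le: "1 \<le> decreasing_rearrangement y ! 0"
  shows "decreasing_rearrangement y = 1 # replicate (CARD('m) - 1) 0"
proof -
  have len: "length (decreasing_rearrangement y) = CARD('m)"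
    by (rule length_decreasing_rearrangement)
  then obtain c r where cr: "decreasing_rearrangement y = c # r"
    by (cases "decreasing_rearrangement y") auto
  have "set r \<subseteq> range (\<lambda>i. y $ i)"
    using set_decreasing_rearrangement[of y] by (auto simp: cr)
  then have nonneg: "\<And>z. z \<in> set r \<Longrightarrow> 0 \<le> z"
    using y by (auto simp: prob_simplex_def)
  have sum: "c + sum_list r = 1"
    using y sum_list_decreasing_rearrangement[of y] by (simp add: cr prob_simplex_def)
  have "1 \<le> c"
    using le by (simp add: cr)
  \<comment> \<open>The total is 1 and the head already uses up at least 1, so a nonnegative tail
    sum must be 0. This also turns \<open>1 \<le> c\<close> into \<open>c = 1\<close>.\<close>
  then have r0: "sum_list r = 0"
    using sum sum_list_nonneg[of r, OF nonneg] by linarith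
  then have "\<forall>z\<in>set r. z = 0"
    using sum_list_nonneg_eq_0_iff nonneg by blast
  then have "r = replicate (CARD('m) - 1) 0"
    using len by (intro replicate_eqI) (auto simp: cr)
  with cr r0 sum show ?thesis
    by simp
qed

theorem lemma3p1:
  fixes p :: "'m::finite \<Rightarrow> 'm \<Rightarrow> 'm \<Rightarrow> real"
    and V :: "real ^ 'm \<Rightarrow> real ^ 'm"
  assumes "qso_with_coeffs p V"
    and "dissipative V"
  shows "\<forall>i. decreasing_rearrangement (coeff_vector p i i) = 1 # replicate (CARD('m) - 1) 0"
proof
  fix i
  have "axis i 1 \<prec>\<^sub>m coeff_vector p i i"
    using assms(2) axis_in_prob_simplex[of i] qso_axis[OF assms(1), of i]
    by (auto simp: dissipative_def)
  then have "decreasing_rearrangement (axis i (1::real)) ! 0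
      \<le> decreasing_rearrangement (coeff_vector p i i) ! 0"
    by (rule majorized_decreasing_rearrangement_0)
  \<comment> \<open>The head dominates coordinate \<open>i\<close> of the vertex, which is
    1.\<close>
  moreover have "1 \<le> decreasing_rearrangement (axis i (1::real)) ! 0"
    using component_le_decreasing_rearrangement_0[of "axis i (1::real)" i] by simp
  moreover have "coeff_vector p i i \<in> prob_simplex"
    using assms(1) by (simp add: qso_with_coeffs_def coeff_vector_in_prob_simplex)
  ultimately show "decreasing_rearrangement (coeff_vector p i i) = 1 # replicate (CARD('m) - 1) 0"
    by (intro decreasing_rearrangement_vertex) auto
qed

end
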